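(* Let $\sigma>1$. Then for every $\rho>0$, $$f_{\rho,\sigma}\in\mathcal E_\sigma(\mathbb R)\setminus\bigcup_{1<\sigma'<\sigma}\mathcal E_{\sigma'}(\mathbb R).$$
   Context: $W$ is the principal branch of the Lambert function (the inverse of $z\mapsto ze^z$). For $\sigma>1$ put $\omega_\sigma(x)=x^{\frac{\sigma}{\sigma-1}}/W^{\frac1{\sigma-1}}(x)$ for $x>0$, $\omega_\sigma(0)=0$; $g_\sigma(x)=\omega_\sigma(\ln(1+|x|))$ for $x\in\mathbb R$; and for $\rho>0$, $f_{\rho,\sigma}(x)=e^{-\rho g_\sigma(1/x)}$ for $x\neq0$, $f_{\rho,\sigma}(0)=0$. Extended Gevrey classes: for $\tau>0$, $\sigma>1$ let $M_0^{\tau,\sigma}=1$ and $M_p^{\tau,\sigma}=p^{\tau p^{\sigma}}$ for $p\in\mathbb N=\{1,2,\dots\}$. A smooth function $\phi$ on $\mathbb R$ belongs to $\mathcal E_{\tau,\sigma}(\mathbb R)$ if for every compact $\mathbb K\subset\mathbb R$ there is $C>0$ such that $\sup_{x\in\mathbb K}|\phi^{(p)}(x)|\le C^{p^{\sigma}+1}M_p^{\tau,\sigma}$ for all $p\in\mathbb N_0$. Set $\mathcal E_\sigma(\mathbb R)=\bigcup_{\tau>0}\mathcal E_{\tau,\sigma}(\mathbb R)$. *)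

theory Defs
  imports "HOL-Analysis.Analysis"
begin

text \<open>The principal branch of the Lambert function, restricted to its real arguments
  \<open>x \<ge> - exp (- 1)\<close>; \<open>w \<mapsto> w * exp w\<close> maps \<open>{- 1..}\<close> bijectively onto these.\<close>

definition Lambert_W :: "real \<Rightarrow> real" where
  "Lambert_W = the_inv_into {- 1..} (\<lambda>w. w * exp w)"

text \<open>Only \<open>x \<ge> 0\<close> is meaningful here; negative arguments get the dummy value \<open>0\<close>.\<close>

definition omega :: "real \<Rightarrow> real \<Rightarrow> real" where
  "omega \<sigma> x =
     (if x > 0 then x powr (\<sigma> / (\<sigma> - 1)) / Lambert_W x powr (1 / (\<sigma> - 1)) else 0)"

definition g_fun :: "real \<Rightarrow> real \<Rightarrow> real" where
  "g_fun \<sigma> x = omega \<sigma> (ln (1 + \<bar>x\<bar>))"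

definition f_fun :: "real \<Rightarrow> real \<Rightarrow> real \<Rightarrow> real" where
  "f_fun \<rho> \<sigma> x = (if x \<noteq> 0 then exp (- \<rho> * g_fun \<sigma> (1 / x)) else 0)"

definition smooth_real :: "(real \<Rightarrow> real) \<Rightarrow> bool" where
  "smooth_real \<phi> \<longleftrightarrow> (\<forall>p. (deriv ^^ p) \<phi> differentiable_on UNIV)"

definition M_seq :: "real \<Rightarrow> real \<Rightarrow> nat \<Rightarrow> real" where
  "M_seq \<tau> \<sigma> p = (if p = 0 then 1 else real p powr (\<tau> * real p powr \<sigma>))"

text \<open>The bound on the supremum over \<open>K\<close> is written pointwise, which also covers \<open>K = {}\<close>.\<close>

definition ext_gevrey :: "real \<Rightarrow> real \<Rightarrow> (real \<Rightarrow> real) set" where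
  "ext_gevrey \<tau> \<sigma> =
     {\<phi>. smooth_real \<phi> \<and>
        (\<forall>K. compact K \<longrightarrow>
          (\<exists>C>0. \<forall>p. \<forall>x\<in>K.
             \<bar>(deriv ^^ p) \<phi> x\<bar> \<le> C powr (real p powr \<sigma> + 1) * M_seq \<tau> \<sigma> p))}"

definition ext_gevrey_union :: "real \<Rightarrow> (real \<Rightarrow> real) set" where
  "ext_gevrey_union \<sigma> = (\<Union>\<tau>\<in>{0<..}. ext_gevrey \<tau> \<sigma>)"

end

theory Submission
  imports Defs "HOL-Real_Asymp.Real_Asymp"
begin

text \<open>Put \<open>b = 1 / (\<sigma> - 1)\<close> and, for \<open>x > 0\<close>, \<open>w = Lambert_W (ln (1 + 1 / x))\<close>, so that
  \<open>f_fun \<rho> \<sigma> x = exp (- \<rho> * w * exp ((1 + b) * w))\<close>. The polynomials in \<open>1 / x\<close>, \<open>1 / (1 + x)\<close>,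
  \<open>exp (- w)\<close>, \<open>1 / (1 + w)\<close>, \<open>exp (b * w)\<close> are closed under differentiation and contain the
  logarithmic derivative of \<open>f_fun \<rho> \<sigma>\<close>. Hence the \<open>p\<close>-th derivative is \<open>G\<^sub>p * f_fun \<rho> \<sigma>\<close>, where
  \<open>G\<^sub>p\<close> is such a polynomial of degree \<open>O(p)\<close> with coefficients of absolute sum \<open>O(1)^p * p!\<close>, so it
  is dominated by a constant power of \<open>(1 + 1 / x) ^ p\<close>. Maximising \<open>(1 + 1 / x) powr N * f_fun \<rho> \<sigma> x\<close>,
  which equals \<open>exp (w * exp w * (N - \<rho> * exp (b * w)))\<close>, yields the factor
  \<open>exp (O(p powr \<sigma> * ln p))\<close>.

  Conversely, \<open>f_fun \<rho> \<sigma>\<close> is flat at \<open>0\<close>, so derivative bounds with an exponent \<open>\<sigma>' < \<sigma>\<close>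
  would by Taylor's formula make \<open>f_fun \<rho> \<sigma> x\<close> too small when \<open>exp (b * w) = p / (\<rho> + 1)\<close> and
  \<open>p\<close> is large.\<close>

section \<open>Lambert function on the positive half-line\<close>

lemma strict_mono_on_times_exp: "strict_mono_on {- 1..} (\<lambda>w::real. w * exp w)"
proof (rule strict_mono_onI)
  fix x y :: real
  assume xy: "x \<in> {- 1..}" "y \<in> {- 1..}" "x < y"
  show "x * exp x < y * exp y"
  proof (rule DERIV_pos_imp_increasing_open[OF xy(3)])
    fix t assume t: "x < t" "t < y"
    have "((\<lambda>w. w * exp w) has_real_derivative (1 + t) * exp t) (at t)"
      by (auto intro!: derivative_eq_intros simp: algebra_simps)
    moreover have "(1 + t) * exp t > 0" using xy t by auto
    ultimately show "\<exists>z. ((\<lambda>w. w * exp w) has_real_derivative z) (at t) \<and> 0 < z" by blast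
  qed (auto intro!: continuous_intros)
qed

lemma Lambert_W_times_exp: "w \<ge> - 1 \<Longrightarrow> Lambert_W (w * exp w) = w"
  unfolding Lambert_W_def
  using the_inv_into_f_f[OF strict_mono_on_imp_inj_on[OF strict_mono_on_times_exp]] by auto

lemma Lambert_W_pos_obtain:
  assumes "y > 0"
  obtains w where "w > 0" "w * exp w = y" "Lambert_W y = w"
proof -
  have "\<exists>w\<ge>0. w \<le> y \<and> w * exp w = y"
    \<comment> \<open>On \<open>[0, y]\<close> the endpoint \<open>w = y\<close> already gives a
      value \<open>y * exp y >= y\<close>.\<close>
    by (rule IVT') (use assms in \<open>auto intro!: continuous_intros\<close>)
  then obtain w where w: "w \<ge> 0" "w * exp w = y" by blast
  moreover from w assms have "w \<noteq> 0" by auto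
  ultimately show ?thesis using that[of w] Lambert_W_times_exp[of w] by auto
qed

lemma Lambert_W_pos: "y > 0 \<Longrightarrow> Lambert_W y > 0"
  and Lambert_W_inverse: "y > 0 \<Longrightarrow> Lambert_W y * exp (Lambert_W y) = y"
  by (metis Lambert_W_pos_obtain)+

lemma Lambert_W_le: "y > 0 \<Longrightarrow> Lambert_W y \<le> y"
  using Lambert_W_pos[of y] Lambert_W_inverse[of y]
  by (metis less_eq_real_def mult_le_cancel_left1 one_le_exp_iff linorder_not_le)

text \<open>This is the inverse function rule, with \<open>1 / ((1 + w) * exp w)\<close> split into
  the factors \<open>exp (- w)\<close> and \<open>1 / (1 + w)\<close>, which later serve as
  generators.\<close>

lemma has_real_derivative_Lambert_W:
  assumes "y > 0"
  shows "(Lambert_W has_real_derivative exp (- Lambert_W y) / (1 + Lambert_W y)) (at y)"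
proof -
  define w where "w = Lambert_W y"
  have w: "w > 0" "w * exp w = y"
    using Lambert_W_pos[OF assms] Lambert_W_inverse[OF assms] by (auto simp: w_def)
  \<comment> \<open>The derivative rule for inverses presupposes continuity of the inverse. The
    radius \<open>w\<close> keeps the neighbourhood of \<open>w\<close> inside the nonnegative
    reals, where \<open>Lambert_W\<close> does invert.\<close>
  have "isCont Lambert_W (w * exp w)"
    by (rule isCont_inverse_function[where d = w and f = "\<lambda>w. w * exp w"])
       (use w in \<open>auto intro!: Lambert_W_times_exp continuous_intros\<close>)
  then have cont: "isCont Lambert_W y" using w by simp
  have "(Lambert_W has_real_derivative inverse ((1 + w) * exp w)) (at y)"
  proof (rule DERIV_inverse_function[where f = "\<lambda>w. w * exp w" and a = 0 and b = "y + 1"])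
    show "((\<lambda>w. w * exp w) has_real_derivative (1 + w) * exp w) (at (Lambert_W y))"
      unfolding w_def[symmetric] by (auto intro!: derivative_eq_intros simp: algebra_simps)
  qed (use w assms cont in \<open>auto intro: Lambert_W_inverse\<close>)
  then show ?thesis by (simp add: w_def exp_minus field_simps)
qed

section \<open>The substitution \<open>w\<close> and the closed form of the function\<close>

definition w_fun :: "real \<Rightarrow> real" where
  "w_fun x = Lambert_W (ln (1 + 1 / x))"

lemma ln_one_plus_inverse_pos: "x > 0 \<Longrightarrow> 0 < ln (1 + 1 / x :: real)"
  by (rule ln_gt_zero) auto

lemma w_fun_pos: "x > 0 \<Longrightarrow> w_fun x > 0"
  unfolding w_fun_def by (intro Lambert_W_pos ln_one_plus_inverse_pos)

lemma w_fun_inverse: "x > 0 \<Longrightarrow> w_fun x * exp (w_fun x) = ln (1 + 1 / x)"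
  unfolding w_fun_def by (intro Lambert_W_inverse ln_one_plus_inverse_pos)

lemma w_fun_le: "x > 0 \<Longrightarrow> w_fun x \<le> ln (1 + 1 / x)"
  unfolding w_fun_def by (intro Lambert_W_le ln_one_plus_inverse_pos)

text \<open>The right-hand side is kept as a product of four generators, so that differentiating any
  expression in \<open>w_fun\<close> stays polynomial in them.\<close>

lemma has_real_derivative_w_fun:
  assumes "x > 0"
  shows "(w_fun has_real_derivative
            - (1 / x) * (1 / (1 + x)) * exp (- w_fun x) * (1 / (1 + w_fun x))) (at x)"
proof -
  have "((\<lambda>x. ln (1 + 1 / x)) has_real_derivative - (1 / x) * (1 / (1 + x))) (at x)"
    using assms by (auto intro!: derivative_eq_intros simp: field_simps add_pos_pos)
  from DERIV_chain2[OF has_real_derivative_Lambert_W[OF ln_one_plus_inverse_pos[OF assms]] this]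
  show ?thesis by (simp add: w_fun_def[abs_def] mult_ac)
qed

text \<open>Since \<open>\<sigma> / (\<sigma> - 1) = 1 + b\<close> with
  \<open>b = 1 / (\<sigma> - 1)\<close>, putting \<open>w * exp w\<close> for the argument of
  \<open>omega\<close> makes the powers of \<open>w\<close> cancel down to a single
  \<open>w\<close>.\<close>

lemma f_fun_eq_exp:
  assumes "\<sigma> > 1" "x > 0"
  shows "f_fun \<rho> \<sigma> x = exp (- \<rho> * (w_fun x * exp ((1 + 1 / (\<sigma> - 1)) * w_fun x)))"
proof -
  define b where "b = 1 / (\<sigma> - 1)"
  have a: "\<sigma> / (\<sigma> - 1) = 1 + b" using assms by (simp add: b_def field_simps)
  define w where "w = w_fun x"
  have w: "w > 0" "ln (1 + 1 / x) = w * exp w"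
    using w_fun_pos w_fun_inverse assms by (auto simp: w_def)
  have W: "Lambert_W (w * exp w) = w" using w by (intro Lambert_W_times_exp) auto
  have "g_fun \<sigma> (1 / x) = omega \<sigma> (w * exp w)"
    using assms w by (simp add: g_fun_def)
  also have "\<dots> = (w * exp w) powr (1 + b) / w powr b"
    using w by (simp add: omega_def W a) (simp add: b_def)
  also have "\<dots> = w * exp ((1 + b) * w)"
    using w by (simp add: powr_mult powr_add exp_powr_real mult_ac exp_add[symmetric] algebra_simps)
  finally show ?thesis using assms by (simp add: f_fun_def w_def b_def)
qed

lemma f_fun_minus: "f_fun \<rho> \<sigma> (- x) = f_fun \<rho> \<sigma> x"
  by (simp add: f_fun_def g_fun_def)

section \<open>Polynomials in the generators: size and differentiation\<close>

text \<open>\<open>gen_poly b d c\<close> contains the functions on \<open>{0<..}\<close> that are polynomials of degree at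
  most \<open>d\<close> in the five generators, with coefficients of absolute sum at most \<open>c\<close>.\<close>

inductive gen_poly :: "real \<Rightarrow> nat \<Rightarrow> real \<Rightarrow> (real \<Rightarrow> real) \<Rightarrow> bool" for b where
  const: "gen_poly b 0 \<bar>c\<bar> (\<lambda>_. c)"
| gen_u: "gen_poly b 1 1 (\<lambda>x. 1 / x)"
| gen_v: "gen_poly b 1 1 (\<lambda>x. 1 / (1 + x))"
| gen_s: "gen_poly b 1 1 (\<lambda>x. exp (- w_fun x))"
| gen_r: "gen_poly b 1 1 (\<lambda>x. 1 / (1 + w_fun x))"
| gen_z: "gen_poly b 1 1 (\<lambda>x. exp (b * w_fun x))"
| add: "gen_poly b d c F \<Longrightarrow> gen_poly b d c' G \<Longrightarrow> gen_poly b d (c + c') (\<lambda>x. F x + G x)"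
| mult: "gen_poly b d c F \<Longrightarrow> gen_poly b d' c' G \<Longrightarrow> gen_poly b (d + d') (c * c') (\<lambda>x. F x * G x)"
| weaken: "gen_poly b d c F \<Longrightarrow> d \<le> d' \<Longrightarrow> c \<le> c' \<Longrightarrow> gen_poly b d' c' F"

lemma gen_poly_cmult:
  assumes "gen_poly b d c F"
  shows "gen_poly b d (\<bar>k\<bar> * c) (\<lambda>x. k * F x)"
  using gen_poly.mult[OF gen_poly.const[of b k] assms] by simp

lemma gen_poly_nonneg: "gen_poly b d c F \<Longrightarrow> c \<ge> 0"
  by (induction rule: gen_poly.induct) auto

text \<open>Every generator is at most \<open>B = (1 + 1 / x) powr (1 + b)\<close>:
  \<open>1 / x\<close> trivially, \<open>exp (b * w)\<close> because
  \<open>w \<le> ln (1 + 1 / x)\<close>, and the other three because they are at most 1. As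
  \<open>B \<ge> 1\<close>, raising the degree is harmless.\<close>

lemma gen_poly_bound:
  assumes "gen_poly b d c F" "x > 0" "b \<ge> 0"
  shows "\<bar>F x\<bar> \<le> c * ((1 + 1 / x) powr (1 + b)) ^ d"
proof -
  define B where "B = (1 + 1 / x) powr (1 + b)"
  have E: "1 + 1 / x \<ge> 1" using assms by auto
  have EB: "1 + 1 / x \<le> B" unfolding B_def
    using powr_mono[of 1 "1 + b" "1 + 1 / x"] E assms by auto
  have B: "B \<ge> 1" using E EB by linarith
  have w: "w_fun x > 0" using w_fun_pos assms by auto
  have "exp (b * w_fun x) \<le> exp (b * ln (1 + 1 / x))"
    using w_fun_le[of x] assms by (auto intro: mult_left_mono)
  also have "\<dots> = (1 + 1 / x) powr b" using assms by (simp add: powr_def add_pos_pos less_imp_neq[THEN not_sym])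
  also have "\<dots> \<le> B" unfolding B_def using E by (intro powr_mono) auto
  finally have z: "exp (b * w_fun x) \<le> B" .
  have "\<bar>F x\<bar> \<le> c * B ^ d" using assms(1)
  proof (induction rule: gen_poly.induct)
    case gen_u then show ?case using EB assms by auto
  next
    case gen_v
    have "1 / (1 + x) \<le> 1" using assms by auto
    then have "1 / (1 + x) \<le> B" using B by linarith
    then show ?case using assms by simp
  next
    case gen_s
    have "exp (- w_fun x) \<le> 1" using w by auto
    then have "exp (- w_fun x) \<le> B" using B by linarith
    then show ?case by simp
  next
    case gen_r
    have "1 / (1 + w_fun x) \<le> 1" using w by auto
    then have "1 / (1 + w_fun x) \<le> B" using B by linarith
    then show ?case using w by simp
  next
    case (add d c F c' G)
    then show ?case by (auto simp: distrib_right)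
  next
    case (mult d c F d' c' G)
    have "\<bar>F x * G x\<bar> \<le> (c * B ^ d) * (c' * B ^ d')"
      unfolding abs_mult using mult gen_poly_nonneg[of b d c F] B by (intro mult_mono) auto
    then show ?case by (simp add: power_add mult_ac)
  next
    case (weaken d c F d' c')
    have "c * B ^ d \<le> c' * B ^ d'"
      using weaken gen_poly_nonneg[of b d c F] B by (intro mult_mono power_increasing) auto
    then show ?case using weaken by linarith
  qed (use z in auto)
  then show ?thesis by (simp add: B_def)
qed

text \<open>Each generator has a derivative of degree at most 6 and coefficient sum at most
  \<open>1 + b\<close>. The worst degree comes from \<open>1 / (1 + w)\<close>, whose square is
  multiplied by the four factors of the derivative of \<open>w\<close>; the factor \<open>b\<close>
  comes from \<open>exp (b * w)\<close>. By the product rule a monomial of degree \<open>d\<close>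
  yields \<open>d\<close> such terms, hence the factor \<open>real d * (1 + b)\<close>.\<close>

lemma gen_poly_deriv:
  assumes "gen_poly b d c F" "b \<ge> 0"
  shows "\<exists>G. gen_poly b (d + 5) (c * (real d * (1 + b))) G \<and>
             (\<forall>x>0. (F has_real_derivative G x) (at x))"
  using assms(1)
proof (induction rule: gen_poly.induct)
  case (const c)
  show ?case
    using gen_poly.weaken[OF gen_poly.const[of b 0], where d' = 5 and c' = 0] by (intro exI[of _ "\<lambda>_. 0"]) auto
next
  case gen_u
  have "gen_poly b (1 + 5) (1 * (real 1 * (1 + b))) (\<lambda>x. - 1 * ((1 / x) * (1 / x)))"
    by (rule gen_poly.weaken[OF gen_poly_cmult[OF gen_poly.mult[OF gen_poly.gen_u gen_poly.gen_u]]])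
       (use assms in auto)
  moreover have "((\<lambda>x. 1 / x) has_real_derivative - 1 * ((1 / x) * (1 / x))) (at x)"
    if "x > 0" for x :: real
    using that by (auto intro!: derivative_eq_intros)
  ultimately show ?case by blast
next
  case gen_v
  have "gen_poly b (1 + 5) (1 * (real 1 * (1 + b))) (\<lambda>x. - 1 * ((1 / (1 + x)) * (1 / (1 + x))))"
    by (rule gen_poly.weaken[OF gen_poly_cmult[OF gen_poly.mult[OF gen_poly.gen_v gen_poly.gen_v]]])
       (use assms in auto)
  moreover have "((\<lambda>x. 1 / (1 + x)) has_real_derivative - 1 * ((1 / (1 + x)) * (1 / (1 + x)))) (at x)"
    if "x > 0" for x :: real
    using that by (auto intro!: derivative_eq_intros)
  ultimately show ?case by blast
next
  case gen_s
  let ?G = "\<lambda>x. exp (- w_fun x) * ((1 / x) * (1 / (1 + x)) * exp (- w_fun x) * (1 / (1 + w_fun x)))"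
  have "gen_poly b (1 + 5) (1 * (real 1 * (1 + b))) ?G"
    by (rule gen_poly.weaken[OF gen_poly.mult[OF gen_poly.gen_s gen_poly.mult[OF gen_poly.mult[OF gen_poly.mult[OF
          gen_poly.gen_u gen_poly.gen_v] gen_poly.gen_s] gen_poly.gen_r]]])
       (use assms in auto)
  moreover have "((\<lambda>x. exp (- w_fun x)) has_real_derivative ?G x) (at x)" if "x > 0" for x
    using that
    by (auto intro!: derivative_eq_intros has_real_derivative_w_fun)
  ultimately show ?case by blast
next
  case gen_r
  let ?G = "\<lambda>x. (1 / (1 + w_fun x)) * (1 / (1 + w_fun x)) *
              ((1 / x) * (1 / (1 + x)) * exp (- w_fun x) * (1 / (1 + w_fun x)))"
  have "gen_poly b (1 + 5) (1 * (real 1 * (1 + b))) ?G"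
    by (rule gen_poly.weaken[OF gen_poly.mult[OF gen_poly.mult[OF gen_poly.gen_r gen_poly.gen_r] gen_poly.mult[OF gen_poly.mult[OF gen_poly.mult[OF
          gen_poly.gen_u gen_poly.gen_v] gen_poly.gen_s] gen_poly.gen_r]]])
       (use assms in auto)
  moreover have "((\<lambda>x. 1 / (1 + w_fun x)) has_real_derivative ?G x) (at x)" if "x > 0" for x
    using that w_fun_pos[of x]
    by (auto intro!: derivative_eq_intros has_real_derivative_w_fun)
  ultimately show ?case by blast
next
  case gen_z
  let ?G = "\<lambda>x. - b * (exp (b * w_fun x) *
              ((1 / x) * (1 / (1 + x)) * exp (- w_fun x) * (1 / (1 + w_fun x))))"
  have "gen_poly b (1 + 5) (1 * (real 1 * (1 + b))) ?G"
    by (rule gen_poly.weaken[OF gen_poly_cmult[OF gen_poly.mult[OF gen_poly.gen_z gen_poly.mult[OF gen_poly.mult[OF gen_poly.mult[OF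
          gen_poly.gen_u gen_poly.gen_v] gen_poly.gen_s] gen_poly.gen_r]]]])
       (use assms in auto)
  moreover have "((\<lambda>x. exp (b * w_fun x)) has_real_derivative ?G x) (at x)" if "x > 0" for x
    using that
    by (auto intro!: derivative_eq_intros has_real_derivative_w_fun)
  ultimately show ?case by blast
next
  case (add d c F c' G)
  then obtain F' G' where *:
    "gen_poly b (d + 5) (c * (real d * (1 + b))) F'" "\<And>x. x > 0 \<Longrightarrow> (F has_real_derivative F' x) (at x)"
    "gen_poly b (d + 5) (c' * (real d * (1 + b))) G'" "\<And>x. x > 0 \<Longrightarrow> (G has_real_derivative G' x) (at x)"
    by blast
  show ?case
    by (rule exI[of _ "\<lambda>x. F' x + G' x"])
       (use * gen_poly.add[OF *(1,3)] in \<open>auto intro!: derivative_eq_intros simp: distrib_right\<close>)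
next
  case (mult d c F d' c' G)
  then obtain F' G' where *:
    "gen_poly b (d + 5) (c * (real d * (1 + b))) F'" "\<And>x. x > 0 \<Longrightarrow> (F has_real_derivative F' x) (at x)"
    "gen_poly b (d' + 5) (c' * (real d' * (1 + b))) G'" "\<And>x. x > 0 \<Longrightarrow> (G has_real_derivative G' x) (at x)"
    by blast
  have "gen_poly b (d + d' + 5) (c * (real d * (1 + b)) * c' + c * (c' * (real d' * (1 + b))))
          (\<lambda>x. F' x * G x + F x * G' x)"
    by (rule gen_poly.add[OF gen_poly.weaken[OF gen_poly.mult[OF *(1) mult(2)]]
            gen_poly.weaken[OF gen_poly.mult[OF mult(1) *(3)]]]) auto
  moreover have "c * (real d * (1 + b)) * c' + c * (c' * (real d' * (1 + b)))
                 = c * c' * (real (d + d') * (1 + b))"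
    by (simp add: algebra_simps)
  moreover have "((\<lambda>x. F x * G x) has_real_derivative F' x * G x + F x * G' x) (at x)"
    if "x > 0" for x
    using DERIV_mult[OF *(2)[OF that] *(4)[OF that]] by (simp add: mult.commute)
  ultimately show ?case by (intro exI[of _ "\<lambda>x. F' x * G x + F x * G' x"]) simp
next
  case (weaken d c F d' c')
  then obtain G where G: "gen_poly b (d + 5) (c * (real d * (1 + b))) G"
    "\<forall>x>0. (F has_real_derivative G x) (at x)" by blast
  have "c * (real d * (1 + b)) \<le> c' * (real d' * (1 + b))"
    using weaken gen_poly_nonneg[of b d c F] assms by (intro mult_mono) auto
  with G weaken show ?case by (intro exI[of _ G] conjI gen_poly.weaken[OF G(1)]) auto
qed

section \<open>Derivatives of all orders and flatness at the origin\<close>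

text \<open>The factor \<open>exp (- w)\<close> from the derivative of \<open>w\<close> reduces
  \<open>exp ((1 + b) * w)\<close> to \<open>exp (b * w)\<close>, and
  \<open>(1 + (1 + b) * w) / (1 + w) = 1 + b - b / (1 + w)\<close>. This puts the logarithmic
  derivative into the form of a polynomial in the generators.\<close>

lemma has_real_derivative_f_fun:
  fixes \<sigma> \<rho> :: real
  assumes "\<sigma> > 1" "x > 0"
  defines "b \<equiv> 1 / (\<sigma> - 1)"
  shows "(f_fun \<rho> \<sigma> has_real_derivative
           \<rho> * ((1 / x) * (1 / (1 + x)) * exp (b * w_fun x) * (1 + b + - b * (1 / (1 + w_fun x))))
             * f_fun \<rho> \<sigma> x) (at x)"
proof -
  have nz: "1 + w_fun x \<noteq> 0" "1 + x \<noteq> 0" "x \<noteq> 0"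
    using w_fun_pos[OF assms(2)] assms(2) by auto
  have e: "exp ((1 + b) * w_fun x) = exp (w_fun x) * exp (b * w_fun x)"
    by (simp add: exp_add distrib_right)
  have "((\<lambda>x. exp (- \<rho> * (w_fun x * exp ((1 + b) * w_fun x)))) has_real_derivative
           \<rho> * ((1 / x) * (1 / (1 + x)) * exp (b * w_fun x) * (1 + b + - b * (1 / (1 + w_fun x))))
             * exp (- \<rho> * (w_fun x * exp ((1 + b) * w_fun x)))) (at x)"
    apply (rule derivative_eq_intros has_real_derivative_w_fun[OF assms(2)] refl)+
    using nz unfolding e exp_minus
    apply (simp add: divide_simps)
    apply (simp add: algebra_simps)
    done
  then have "(f_fun \<rho> \<sigma> has_real_derivative
           \<rho> * ((1 / x) * (1 / (1 + x)) * exp (b * w_fun x) * (1 + b + - b * (1 / (1 + w_fun x))))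
             * exp (- \<rho> * (w_fun x * exp ((1 + b) * w_fun x)))) (at x)"
    by (rule has_field_derivative_transform_within[where d = x])
       (use assms in \<open>auto simp: f_fun_eq_exp dist_real_def\<close>)
  then show ?thesis using assms by (simp add: f_fun_eq_exp)
qed

text \<open>\<open>T\<close> is a threshold for \<open>exp (b * w)\<close>. Above it the exponent
  \<open>w * exp w * (N - \<rho> * exp (b * w))\<close> is nonpositive; below it
  \<open>w \<le> (\<sigma> - 1) * ln T\<close>, and the negative term may be dropped.\<close>

lemma f_fun_growth:
  assumes "\<sigma> > 1" "\<rho> > 0" "x > 0" "N \<ge> 0" "T \<ge> 1" "N \<le> \<rho> * T"
  shows "(1 + 1 / x) powr N * f_fun \<rho> \<sigma> x \<le> exp (N * ((\<sigma> - 1) * ln T * T powr (\<sigma> - 1)))"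
proof -
  define b where "b = 1 / (\<sigma> - 1)"
  define w where "w = w_fun x"
  have w: "w > 0" "ln (1 + 1 / x) = w * exp w"
    using w_fun_pos w_fun_inverse assms by (auto simp: w_def)
  have pos: "1 + 1 / x > 0" using assms by (auto intro: add_pos_pos)
  have "(1 + 1 / x) powr N * f_fun \<rho> \<sigma> x
          = exp (N * (w * exp w)) * exp (- \<rho> * (w * exp ((1 + b) * w)))"
    using assms w pos by (simp add: f_fun_eq_exp powr_def b_def w_def)
  also have "\<dots> = exp (w * exp w * (N - \<rho> * exp (b * w)))"
    by (simp add: exp_add[symmetric] algebra_simps)
  also have "w * exp w * (N - \<rho> * exp (b * w)) \<le> N * ((\<sigma> - 1) * ln T * T powr (\<sigma> - 1))"
  proof (cases "exp (b * w) \<le> T")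
    case True
    then have "b * w \<le> ln T" using assms by (metis exp_le_cancel_iff exp_ln less_le_trans zero_less_one)
    then have wl: "w \<le> (\<sigma> - 1) * ln T" using assms by (simp add: b_def field_simps)
    have "exp w \<le> T powr (\<sigma> - 1)" using wl assms by (simp add: powr_def)
    then have *: "w * exp w \<le> (\<sigma> - 1) * ln T * T powr (\<sigma> - 1)"
      using wl w assms by (intro mult_mono) auto
    have "w * exp w * (N - \<rho> * exp (b * w)) \<le> w * exp w * N"
      using w assms by (intro mult_left_mono) auto
    also have "\<dots> \<le> N * ((\<sigma> - 1) * ln T * T powr (\<sigma> - 1))"
      using mult_left_mono[OF * assms(4)] by (simp add: mult_ac)
    finally show ?thesis .
  next
    case False
    then have "N \<le> \<rho> * exp (b * w)"
      using assms mult_left_mono[of T "exp (b * w)" \<rho>] by linarith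
    then have "w * exp w * (N - \<rho> * exp (b * w)) \<le> 0"
      using w assms by (intro mult_nonneg_nonpos) auto
    also have "0 \<le> N * ((\<sigma> - 1) * ln T * T powr (\<sigma> - 1))" using assms by auto
    finally show ?thesis .
  qed
  finally show ?thesis by simp
qed

lemma gen_poly_times_f_fun_flat:
  assumes "\<sigma> > 1" "\<rho> > 0" "gen_poly b d c G" "b \<ge> 0"
  shows "\<exists>C. \<forall>x>0. \<bar>G x * f_fun \<rho> \<sigma> x\<bar> \<le> C * x\<^sup>2"
proof -
  \<comment> \<open>The summand 2 buys the factor \<open>(1 / (1 + 1 / x))\<^sup>2\<close>, which is
    at most \<open>x\<^sup>2\<close>.\<close>
  define N where "N = (1 + b) * real d + 2"
  define T where "T = max 1 (N / \<rho>)"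
  define C where "C = exp (N * ((\<sigma> - 1) * ln T * T powr (\<sigma> - 1)))"
  have T: "T \<ge> 1" "N \<le> \<rho> * T" "N \<ge> 0"
    using assms by (auto simp: T_def N_def max_def field_simps)
  have "\<bar>G x * f_fun \<rho> \<sigma> x\<bar> \<le> (c * C) * x\<^sup>2" if x: "x > 0" for x
  proof -
    have f: "f_fun \<rho> \<sigma> x > 0" using x by (simp add: f_fun_def)
    have E: "1 + 1 / x > 0" using x by (auto intro: add_pos_pos)
    have "\<bar>G x * f_fun \<rho> \<sigma> x\<bar> \<le> c * ((1 + 1 / x) powr (1 + b)) ^ d * f_fun \<rho> \<sigma> x"
      unfolding abs_mult using f gen_poly_bound[OF assms(3) x assms(4)] by (intro mult_mono) auto
    also have "((1 + 1 / x) powr (1 + b)) ^ d = (1 + 1 / x) powr N * (1 / (1 + 1 / x))\<^sup>2"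
      using E by (simp add: N_def powr_add powr_powr[symmetric] powr_realpow power_divide)
    also have "c * ((1 + 1 / x) powr N * (1 / (1 + 1 / x))\<^sup>2) * f_fun \<rho> \<sigma> x
               = c * ((1 + 1 / x) powr N * f_fun \<rho> \<sigma> x) * (1 / (1 + 1 / x))\<^sup>2" by simp
    also have "\<dots> \<le> c * C * x\<^sup>2"
    proof (intro mult_mono power_mono)
      show "(1 + 1 / x) powr N * f_fun \<rho> \<sigma> x \<le> C" unfolding C_def
        by (rule f_fun_growth) (use assms x T in auto)
      show "1 / (1 + 1 / x) \<le> x" using x E by (simp add: field_simps)
    qed (use f E x gen_poly_nonneg[OF assms(3)] in \<open>auto simp: C_def\<close>)
    finally show ?thesis .
  qed
  then show ?thesis by blast
qed

text \<open>The sign \<open>\<epsilon>\<close> lets one lemma serve both even and odd functions, as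
  the derivatives of an even function alternate in parity. At 0 the quadratic bound forces the
  difference quotient below \<open>C * \<bar>h\<bar>\<close>.\<close>

lemma reflected_flat_has_derivative:
  fixes \<phi> F F' :: "real \<Rightarrow> real"
  assumes pos: "\<And>x. x > 0 \<Longrightarrow> \<phi> x = F x" and neg: "\<And>x. x > 0 \<Longrightarrow> \<phi> (- x) = \<epsilon> * F x"
    and zero: "\<phi> 0 = 0" and \<epsilon>: "\<bar>\<epsilon>\<bar> = 1"
    and F': "\<And>x. x > 0 \<Longrightarrow> (F has_real_derivative F' x) (at x)"
    and flat: "\<And>x. x > 0 \<Longrightarrow> \<bar>F x\<bar> \<le> C * x\<^sup>2"
  shows "x > 0 \<Longrightarrow> (\<phi> has_real_derivative F' x) (at x)"
    and "x > 0 \<Longrightarrow> (\<phi> has_real_derivative - \<epsilon> * F' x) (at (- x))"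
    and "(\<phi> has_real_derivative 0) (at 0)"
proof -
  assume x: "x > 0"
  show "(\<phi> has_real_derivative F' x) (at x)"
    by (rule has_field_derivative_transform_within[OF F'[OF x] x])
       (auto simp: pos dist_real_def)
  have "((\<lambda>y. \<epsilon> * F (- y)) has_real_derivative - \<epsilon> * F' x) (at (- x))"
    using F'[OF x] by (auto intro!: derivative_eq_intros DERIV_chain2[where f = F])
  then show "(\<phi> has_real_derivative - \<epsilon> * F' x) (at (- x))"
    by (rule has_field_derivative_transform_within[where d = x])
       (use x neg[of "- y" for y] in \<open>auto simp: dist_real_def\<close>)
next
  have bound: "\<bar>\<phi> h\<bar> \<le> C * h\<^sup>2" for h
  proof -
    consider "h > 0" | "h = 0" | "h < 0" by linarith
    then show ?thesis
    proof cases
      case 3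
      then show ?thesis using neg[of "- h"] flat[of "- h"] \<epsilon> by (simp add: abs_mult)
    qed (use pos flat zero in auto)
  qed
  have "(\<lambda>h. \<phi> h / h) \<midarrow>0\<rightarrow> 0"
  proof (rule Lim_null_comparison)
    show "eventually (\<lambda>h. norm (\<phi> h / h) \<le> C * \<bar>h\<bar>) (at 0)"
    proof (rule eventually_at_filter[THEN iffD2, OF always_eventually], intro allI impI)
      fix h :: real assume "h \<noteq> 0"
      then show "norm (\<phi> h / h) \<le> C * \<bar>h\<bar>"
        using bound[of h] by (simp add: abs_divide divide_le_eq power2_eq_square mult.assoc)
    qed
    show "((\<lambda>h. C * \<bar>h\<bar>) \<longlongrightarrow> 0) (at 0)" by (auto intro!: tendsto_eq_intros)
  qed
  then show "(\<phi> has_real_derivative 0) (at 0)" by (simp add: DERIV_def zero)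
qed

text \<open>Induction on \<open>p\<close>. Passing from \<open>G\<close> to
  \<open>G' + G * L\<close>, with \<open>L\<close> the logarithmic derivative, raises the degree by
  at most 5 and multiplies the coefficient sum by at most \<open>\<kappa> * (p + 1)\<close>; these
  factors build up \<open>\<kappa> ^ p * fact p\<close>.\<close>

lemma f_fun_higher_deriv:
  assumes "\<sigma> > 1" "\<rho> > 0"
  defines "b \<equiv> 1 / (\<sigma> - 1)"
  defines "\<kappa> \<equiv> 5 * (1 + b) + \<rho> * (1 + 2 * b)"
  shows "\<exists>G. gen_poly b (5 * p) (\<kappa> ^ p * fact p) G \<and>
             (\<forall>x>0. (deriv ^^ p) (f_fun \<rho> \<sigma>) x = G x * f_fun \<rho> \<sigma> x) \<and>
             (\<forall>x>0. (deriv ^^ p) (f_fun \<rho> \<sigma>) (- x) = (- 1) ^ p * (G x * f_fun \<rho> \<sigma> x)) \<and>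
             (deriv ^^ p) (f_fun \<rho> \<sigma>) 0 = 0 \<and>
             (\<forall>x. (deriv ^^ p) (f_fun \<rho> \<sigma>) differentiable (at x))"
proof -
  have b: "b > 0" using assms by (simp add: b_def)
  define D where "D p = (deriv ^^ p) (f_fun \<rho> \<sigma>)" for p
  let ?L = "\<lambda>x. \<rho> * ((1 / x) * (1 / (1 + x)) * exp (b * w_fun x) * (1 + b + - b * (1 / (1 + w_fun x))))"
  have L: "gen_poly b 4 (\<rho> * (1 + 2 * b)) ?L"
    \<comment> \<open>Three generators times an affine factor with coefficients \<open>1 + b\<close>
      and \<open>- b\<close> give degree 4 and coefficient sum
      \<open>\<rho> * (1 + 2 * b)\<close>.\<close>
    by (rule gen_poly.weaken[OF gen_poly_cmult[OF gen_poly.mult[OF gen_poly.mult[OF gen_poly.mult[OF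
          gen_poly.gen_u gen_poly.gen_v] gen_poly.gen_z]
          gen_poly.add[OF gen_poly.weaken[OF gen_poly.const _ order.refl] gen_poly_cmult[OF gen_poly.gen_r]]]]])
       (use b assms in auto)
  define P where "P p G \<longleftrightarrow> gen_poly b (5 * p) (\<kappa> ^ p * fact p) G \<and>
             (\<forall>x>0. D p x = G x * f_fun \<rho> \<sigma> x) \<and>
             (\<forall>x>0. D p (- x) = (- 1) ^ p * (G x * f_fun \<rho> \<sigma> x)) \<and> D p 0 = 0" for p G
  \<comment> \<open>Differentiability of \<open>D p\<close> is a by-product of the step rather than
    part of the invariant: the flatness of \<open>G * f_fun \<rho> \<sigma>\<close> that yields it
    is also what gives \<open>D (Suc p) 0 = 0\<close>.\<close>
  have step: "(\<forall>x. D p differentiable (at x)) \<and> (\<exists>G'. P (Suc p) G')" if "P p G" for p G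
  proof -
    have PG: "\<And>x. x > 0 \<Longrightarrow> D p x = G x * f_fun \<rho> \<sigma> x"
      "\<And>x. x > 0 \<Longrightarrow> D p (- x) = (- 1) ^ p * (G x * f_fun \<rho> \<sigma> x)"
      "D p 0 = 0" "gen_poly b (5 * p) (\<kappa> ^ p * fact p) G"
      using that unfolding P_def by auto
    obtain G' where G': "gen_poly b (5 * p + 5) (\<kappa> ^ p * fact p * (real (5 * p) * (1 + b))) G'"
      "\<forall>x>0. (G has_real_derivative G' x) (at x)"
      using gen_poly_deriv[OF PG(4)] b by auto
    define H where "H x = G' x + G x * ?L x" for x
    obtain C where C: "\<And>x. x > 0 \<Longrightarrow> \<bar>G x * f_fun \<rho> \<sigma> x\<bar> \<le> C * x\<^sup>2"
      using gen_poly_times_f_fun_flat[OF assms(1,2) PG(4)] b by auto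
    have F': "((\<lambda>x. G x * f_fun \<rho> \<sigma> x) has_real_derivative H x * f_fun \<rho> \<sigma> x) (at x)"
      if "x > 0" for x
      unfolding H_def
      using DERIV_mult[OF G'(2)[rule_format, OF that]
          has_real_derivative_f_fun[OF assms(1) that, of \<rho>, folded b_def]]
      by (rule DERIV_cong) (simp add: algebra_simps)
    have sgn: "\<bar>(- 1) ^ p :: real\<bar> = 1" by (simp add: power_abs)
    note d = reflected_flat_has_derivative[where \<phi> = "D p" and \<epsilon> = "(- 1) ^ p"
        and F = "\<lambda>x. G x * f_fun \<rho> \<sigma> x" and F' = "\<lambda>x. H x * f_fun \<rho> \<sigma> x", OF PG(1-3) sgn F' C]
    have DS: "D (Suc p) x = deriv (D p) x" for x by (simp add: D_def)
    have "D p differentiable (at x)" for x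
    proof -
      consider "x > 0" | "x = 0" | "x < 0" by linarith
      then show ?thesis
        by cases (use d(1)[of x] d(2)[of "- x"] d(3) in \<open>auto simp: real_differentiable_def\<close>)
    qed
    moreover have "P (Suc p) H"
      unfolding P_def
    proof (intro conjI allI impI)
      have "gen_poly b (5 * p + 5) (\<kappa> ^ p * fact p * (real (5 * p) * (1 + b))
              + \<kappa> ^ p * fact p * (\<rho> * (1 + 2 * b))) H"
        unfolding H_def by (rule gen_poly.add[OF G'(1) gen_poly.weaken[OF gen_poly.mult[OF PG(4) L]]]) auto
      then show "gen_poly b (5 * Suc p) (\<kappa> ^ Suc p * fact (Suc p)) H"
      proof (rule gen_poly.weaken)
        show "\<kappa> ^ p * fact p * (real (5 * p) * (1 + b)) + \<kappa> ^ p * fact p * (\<rho> * (1 + 2 * b))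
                     \<le> \<kappa> ^ Suc p * fact (Suc p)"
        proof -
          have "0 \<le> (\<rho> * (1 + 2 * b)) * real p"
            using assms(2) b by (intro mult_nonneg_nonneg) auto
          then have *: "real (5 * p) * (1 + b) + \<rho> * (1 + 2 * b) \<le> \<kappa> * real (Suc p)"
            using b unfolding \<kappa>_def by (simp add: algebra_simps)
          have "\<kappa> ^ p * fact p \<ge> 0" using gen_poly_nonneg[OF PG(4)] .
          from mult_left_mono[OF * this] show ?thesis by (simp add: algebra_simps)
        qed
      qed simp
    next
      fix x :: real assume "x > 0"
      then show "D (Suc p) x = H x * f_fun \<rho> \<sigma> x"
        unfolding DS by (intro DERIV_imp_deriv d(1))
    next
      fix x :: real assume "x > 0"
      then show "D (Suc p) (- x) = (- 1) ^ Suc p * (H x * f_fun \<rho> \<sigma> x)"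
        unfolding DS using DERIV_imp_deriv[OF d(2)[of x]] by simp
    next
      show "D (Suc p) 0 = 0" unfolding DS by (intro DERIV_imp_deriv d(3))
    qed
    ultimately show ?thesis by blast
  qed
  have "\<exists>G. P p G"
  proof (induction p)
    case 0
    have "P 0 (\<lambda>_. 1)"
      using gen_poly.const[of b 1] by (auto simp: P_def D_def f_fun_minus) (simp add: f_fun_def)
    then show ?case by blast
  next
    case (Suc p)
    then show ?case using step by blast
  qed
  then obtain G where "P p G" by blast
  with step[OF this] show ?thesis unfolding P_def D_def by blast
qed


section \<open>Derivative bounds and membership in the class\<close>

text \<open>A polynomial of degree \<open>5 * p\<close> costs
  \<open>(1 + 1 / x) powr (m * p)\<close>, which \<open>f_fun_growth\<close> absorbs with
  \<open>N = m * p\<close> and \<open>T = C * p\<close>. The resulting bound is uniform in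
  \<open>x\<close>.\<close>

lemma f_fun_deriv_bound:
  assumes "\<sigma> > 1" "\<rho> > 0"
  shows "\<exists>C A. C \<ge> 1 \<and> A \<ge> 0 \<and> (\<forall>p\<ge>1. \<forall>x.
           \<bar>(deriv ^^ p) (f_fun \<rho> \<sigma>) x\<bar>
             \<le> C ^ p * fact p * exp (A * real p powr \<sigma> * (ln C + ln (real p))))"
proof -
  define b where "b = 1 / (\<sigma> - 1)"
  define \<kappa> where "\<kappa> = 5 * (1 + b) + \<rho> * (1 + 2 * b)"
  define m where "m = 5 * (1 + b)"
  \<comment> \<open>One constant meets three needs: it dominates \<open>\<kappa>\<close>, ensures
    \<open>T = C * p \<ge> 1\<close>, and ensures \<open>m * p \<le> \<rho> * T\<close>.\<close>
  define C where "C = max \<kappa> (max 1 (m / \<rho>))"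
  define A where "A = m * ((\<sigma> - 1) * C powr (\<sigma> - 1))"
  have b: "b > 0" using assms by (simp add: b_def)
  have m: "m > 0" using b by (simp add: m_def)
  have \<kappa>: "\<kappa> > 0" using b assms by (auto simp: \<kappa>_def intro!: add_pos_nonneg)
  have C: "C \<ge> 1" "C \<ge> \<kappa>" "C \<ge> m / \<rho>" by (auto simp: C_def)
  have A: "A \<ge> 0" using assms m by (simp add: A_def)
  have main: "\<bar>(deriv ^^ p) (f_fun \<rho> \<sigma>) x\<bar>
     \<le> C ^ p * fact p * exp (A * real p powr \<sigma> * (ln C + ln (real p)))" if p: "p \<ge> 1" for p x
  proof -
    define R where "R = C ^ p * fact p * exp (A * real p powr \<sigma> * (ln C + ln (real p)))"
    obtain G where G: "gen_poly b (5 * p) (\<kappa> ^ p * fact p) G"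
      "\<forall>x>0. (deriv ^^ p) (f_fun \<rho> \<sigma>) x = G x * f_fun \<rho> \<sigma> x"
      "\<forall>x>0. (deriv ^^ p) (f_fun \<rho> \<sigma>) (- x) = (- 1) ^ p * (G x * f_fun \<rho> \<sigma> x)"
      "(deriv ^^ p) (f_fun \<rho> \<sigma>) 0 = 0"
      using f_fun_higher_deriv[OF assms, of p, folded b_def, folded \<kappa>_def]
      by (elim exE conjE) (rule that)
    have R: "\<bar>G x * f_fun \<rho> \<sigma> x\<bar> \<le> R" if x: "x > 0" for x
    proof -
      have f: "f_fun \<rho> \<sigma> x > 0" using x by (simp add: f_fun_def)
      have E: "1 + 1 / x > 0" using x by (auto intro: add_pos_pos)
      have Cp: "1 \<le> C * real p" using C p mult_mono[of 1 C 1 "real p"] by simp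
      have "m * real p \<le> \<rho> * (C * real p)"
        using C assms mult_right_mono[of m "C * \<rho>" "real p"] by (simp add: field_simps)
      then have "(1 + 1 / x) powr (m * real p) * f_fun \<rho> \<sigma> x
            \<le> exp (m * real p * ((\<sigma> - 1) * ln (C * real p) * (C * real p) powr (\<sigma> - 1)))"
        by (intro f_fun_growth assms x Cp) (use m in auto)
      also have "m * real p * ((\<sigma> - 1) * ln (C * real p) * (C * real p) powr (\<sigma> - 1))
               = A * (real p * real p powr (\<sigma> - 1)) * (ln C + ln (real p))"
        using C p by (simp add: A_def powr_mult ln_mult)
      also have "real p * real p powr (\<sigma> - 1) = real p powr \<sigma>"
        using p by (simp add: powr_diff)
      finally have growth: "(1 + 1 / x) powr (m * real p) * f_fun \<rho> \<sigma> x
            \<le> exp (A * real p powr \<sigma> * (ln C + ln (real p)))" .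
      have "\<bar>G x * f_fun \<rho> \<sigma> x\<bar>
              \<le> \<kappa> ^ p * fact p * ((1 + 1 / x) powr (1 + b)) ^ (5 * p) * f_fun \<rho> \<sigma> x"
        unfolding abs_mult using f gen_poly_bound[OF G(1) x] b by (intro mult_mono) auto
      also have "((1 + 1 / x) powr (1 + b)) ^ (5 * p) = (1 + 1 / x) powr (m * real p)"
        using E by (simp add: m_def powr_realpow[symmetric] powr_powr mult_ac)
      also have "\<kappa> ^ p * fact p * (1 + 1 / x) powr (m * real p) * f_fun \<rho> \<sigma> x
               = \<kappa> ^ p * fact p * ((1 + 1 / x) powr (m * real p) * f_fun \<rho> \<sigma> x)" by simp
      also have "\<dots> \<le> R" unfolding R_def
        by (intro mult_mono growth power_mono) (use \<kappa> C f in auto)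
      finally show ?thesis .
    qed
    have R0: "R \<ge> 0" using C by (simp add: R_def)
    have "\<bar>(deriv ^^ p) (f_fun \<rho> \<sigma>) x\<bar> \<le> R"
    proof -
      consider "x > 0" | "x = 0" | "x < 0" by linarith
      then show ?thesis
      proof cases
        case 3
        then have "(deriv ^^ p) (f_fun \<rho> \<sigma>) x = (- 1) ^ p * (G (- x) * f_fun \<rho> \<sigma> (- x))"
          using G(3)[rule_format, of "- x"] by simp
        then show ?thesis using R[of "- x"] 3 by (simp add: abs_mult power_abs)
      qed (use R R0 G in auto)
    qed
    then show ?thesis by (simp add: R_def)
  qed
  show ?thesis using C(1) A main by blast
qed

text \<open>The parameter is \<open>\<tau> = 1 + A\<close>: the exponential factor contributes
  \<open>A\<close>, and the factorial contributes 1 through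
  \<open>fact p \<le> p ^ p \<le> p powr (p powr \<sigma>)\<close>. The constant \<open>B\<close>
  works for every compact set.\<close>

lemma f_fun_in_ext_gevrey_union:
  assumes "\<sigma> > 1" "\<rho> > 0"
  shows "f_fun \<rho> \<sigma> \<in> ext_gevrey_union \<sigma>"
proof -
  obtain C A where CA: "C \<ge> 1" "A \<ge> 0" and bound: "\<And>p x. p \<ge> 1 \<Longrightarrow>
      \<bar>(deriv ^^ p) (f_fun \<rho> \<sigma>) x\<bar>
        \<le> C ^ p * fact p * exp (A * real p powr \<sigma> * (ln C + ln (real p)))"
    using f_fun_deriv_bound[OF assms] by blast
  \<comment> \<open>The exponent collects \<open>C ^ p\<close>, enlarged to \<open>C powr q\<close>,
    and the part \<open>C powr (A * q)\<close> of the exponential, where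
    \<open>q = p powr \<sigma>\<close>.\<close>
  define B where "B = C powr (1 + A)"
  have B: "B \<ge> 1" using CA by (simp add: B_def ge_one_powr_ge_zero)
  have "\<bar>(deriv ^^ p) (f_fun \<rho> \<sigma>) x\<bar> \<le> B powr (real p powr \<sigma> + 1) * M_seq (1 + A) \<sigma> p" for p x
  proof (cases "p = 0")
    \<comment> \<open>Order 0 lies outside the derivative bound above and is settled by
      \<open>0 \<le> f_fun \<rho> \<sigma> x \<le> 1\<close>.\<close>
    case True
    have "f_fun \<rho> \<sigma> x \<le> 1 \<and> f_fun \<rho> \<sigma> x \<ge> 0"
    proof (cases "x = 0")
      case False
      then have "omega \<sigma> (ln (1 + \<bar>1 / x\<bar>)) \<ge> 0"
        by (auto simp: omega_def)
      then have "exp (- \<rho> * omega \<sigma> (ln (1 + \<bar>1 / x\<bar>))) \<le> 1"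
        using assms by (simp only: exp_le_one_iff) (simp add: mult_nonneg_nonneg)
      then show ?thesis using False unfolding f_fun_def g_fun_def by auto
    qed (simp add: f_fun_def)
    then show ?thesis using True B by (simp add: M_seq_def)
  next
    case False
    define q where "q = real p powr \<sigma>"
    have pq: "real p \<le> q" using False assms powr_mono[of 1 \<sigma> "real p"] by (simp add: q_def)
    have "C ^ p \<le> C powr q"
      using CA pq by (simp add: powr_realpow[symmetric] powr_mono)
    moreover have "fact p \<le> real p powr q"
    proof -
      have "fact p \<le> real p ^ p" using fact_le_power[of p, where 'a = real] by simp
      also have "\<dots> \<le> real p powr q"
        using False pq by (simp add: powr_realpow[symmetric] powr_mono)
      finally show ?thesis .
    qed
    ultimately have "C ^ p * fact p \<le> C powr q * real p powr q"
      using CA by (intro mult_mono) auto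
    then have "C ^ p * fact p * exp (A * q * (ln C + ln (real p)))
        \<le> C powr q * real p powr q * exp (A * q * (ln C + ln (real p)))"
      by (intro mult_right_mono) auto
    also have "\<dots> = B powr q * real p powr ((1 + A) * q)"
      using CA False by (simp add: B_def powr_def exp_add[symmetric] algebra_simps)
    also have "\<dots> \<le> B powr (q + 1) * real p powr ((1 + A) * q)"
      using B by (intro mult_right_mono powr_mono) auto
    finally show ?thesis using bound[of p x] False by (simp add: M_seq_def q_def)
  qed
  moreover have "smooth_real (f_fun \<rho> \<sigma>)"
    using f_fun_higher_deriv[OF assms] unfolding smooth_real_def
    by (auto simp: differentiable_on_def intro: differentiable_at_withinI)
  ultimately have "f_fun \<rho> \<sigma> \<in> ext_gevrey (1 + A) \<sigma>"
    using B unfolding ext_gevrey_def by (auto intro!: exI[of _ B])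
  then show ?thesis using CA by (auto simp: ext_gevrey_union_def intro!: bexI[of _ "1 + A"])
qed

section \<open>Exclusion from the classes with smaller exponent\<close>

text \<open>At a flat point only the Lagrange remainder of Taylor's formula survives; its
  \<open>1 / fact p\<close> is simply bounded by 1.\<close>

lemma abs_le_of_flat_Maclaurin:
  fixes \<phi> :: "real \<Rightarrow> real"
  assumes "smooth_real \<phi>" "\<And>p. (deriv ^^ p) \<phi> 0 = 0"
    and "\<And>t. \<bar>t\<bar> \<le> \<bar>x\<bar> \<Longrightarrow> \<bar>(deriv ^^ p) \<phi> t\<bar> \<le> B"
  shows "\<bar>\<phi> x\<bar> \<le> B * \<bar>x\<bar> ^ p"
proof -
  have "\<forall>m x. ((deriv ^^ m) \<phi> has_real_derivative (deriv ^^ Suc m) \<phi> x) (at x)"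
    using assms(1) by (auto simp: smooth_real_def differentiable_on_def DERIV_deriv_iff_real_differentiable)
  from Maclaurin_all_le[of "\<lambda>p. (deriv ^^ p) \<phi>", OF _ this, of \<phi> x p]
  obtain t where t: "\<bar>t\<bar> \<le> \<bar>x\<bar>" "\<phi> x = (deriv ^^ p) \<phi> t / fact p * x ^ p"
    using assms(2) by auto
  have "\<bar>(deriv ^^ p) \<phi> t / fact p\<bar> \<le> \<bar>(deriv ^^ p) \<phi> t\<bar>"
    by (simp add: abs_divide divide_le_eq mult_le_cancel_left1)
  also have "\<dots> \<le> B" using assms(3)[OF t(1)] .
  finally show ?thesis unfolding t(2) abs_mult power_abs by (intro mult_right_mono) auto
qed

lemma f_fun_notin_ext_gevrey_union:
  assumes "\<sigma> > 1" "\<rho> > 0" "1 < \<sigma>'" "\<sigma>' < \<sigma>"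
  shows "f_fun \<rho> \<sigma> \<notin> ext_gevrey_union \<sigma>'"
proof
  assume "f_fun \<rho> \<sigma> \<in> ext_gevrey_union \<sigma>'"
  then obtain \<tau> where "f_fun \<rho> \<sigma> \<in> ext_gevrey \<tau> \<sigma>'" by (auto simp: ext_gevrey_union_def)
  then obtain C where smooth: "smooth_real (f_fun \<rho> \<sigma>)" and "C > 0"
    and C: "\<And>p x. x \<in> {- 1..1} \<Longrightarrow>
      \<bar>(deriv ^^ p) (f_fun \<rho> \<sigma>) x\<bar> \<le> C powr (real p powr \<sigma>' + 1) * M_seq \<tau> \<sigma>' p"
    unfolding ext_gevrey_def mem_Collect_eq
    by (elim conjE allE[of _ "{- 1..1}"] impE exE) auto
  \<comment> \<open>Exceeding \<open>\<rho>\<close> by 1 leaves, after comparing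
    \<open>p * y\<close> with the exponent of \<open>f_fun \<rho> \<sigma> x\<close>, exactly one
    copy of \<open>w * (p / M) powr \<sigma>\<close>.\<close>
  define M where "M = \<rho> + 1"
  have M: "M > 0" using assms by (simp add: M_def)
  \<comment> \<open>That copy has order \<open>p powr \<sigma> * ln p\<close> and so beats the terms
    coming from the exponent \<open>\<sigma>'\<close>. The second conjunct gives
    \<open>w \<ge> 1\<close>, which places \<open>x\<close> in \<open>[0, 1]\<close>.\<close>
  have ev: "eventually (\<lambda>p. (\<sigma> - 1) * ln (p / M) * (p / M) powr \<sigma> >
      p + (p powr \<sigma>' + 1) * ln C + \<tau> * p powr \<sigma>' * ln p \<and> (\<sigma> - 1) * ln (p / M) \<ge> 1 \<and> p \<ge> 1) at_top"
    using assms M by (intro eventually_conj; real_asymp)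
  obtain p :: nat where p: "(\<sigma> - 1) * ln (real p / M) * (real p / M) powr \<sigma> >
      real p + (real p powr \<sigma>' + 1) * ln C + \<tau> * real p powr \<sigma>' * ln (real p)"
    "(\<sigma> - 1) * ln (real p / M) \<ge> 1" "real p \<ge> 1"
    using eventually_happens[OF filterlim_real_sequentially[unfolded filterlim_iff, rule_format, OF ev]]
    by auto
  \<comment> \<open>This solves \<open>exp (w / (\<sigma> - 1)) = p / M\<close>; \<open>y\<close>
    and \<open>x\<close> are then chosen so that \<open>ln (1 + 1 / x) = y\<close>, that is
    \<open>w_fun x = w\<close>.\<close>
  define w where "w = (\<sigma> - 1) * ln (real p / M)"
  define y where "y = w * exp w"
  define x where "x = 1 / (exp y - 1)"
  have w: "w \<ge> 1" using p by (simp add: w_def)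
  have y: "y \<ge> 1" unfolding y_def using w mult_mono[of 1 w 1 "exp w"] by simp
  have e2: "exp (1 :: real) \<ge> 2" using exp_ge_add_one_self[of "1 :: real"] by simp
  have ey: "exp y \<ge> 2" using e2 y by (meson exp_le_cancel_iff order_trans)
  have x: "x > 0" "x \<le> 1" "1 + 1 / x = exp y"
    using ey y by (auto simp: x_def divide_le_eq)
  \<comment> \<open>Replacing \<open>exp y - 1\<close> by \<open>exp (y - 1)\<close> costs a factor
    \<open>exp 1\<close> in each power of \<open>x\<close>, which accounts for the lone summand
    \<open>p\<close> in \<open>ev\<close>.\<close>
  have xy: "x \<le> exp (1 - y)"
  proof -
    have "1 * 1 \<le> (exp 1 - 1) * exp (y - 1)" using e2 y by (intro mult_mono) auto
    then have "exp (y - 1) \<le> exp y - 1" by (simp add: algebra_simps exp_add[symmetric])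
    then have "x \<le> 1 / exp (y - 1)" unfolding x_def using y by (intro divide_left_mono mult_pos_pos) auto
    then show ?thesis by (simp add: exp_diff)
  qed
  have wx: "w_fun x = w"
    unfolding w_fun_def x(3) ln_exp y_def using w by (intro Lambert_W_times_exp) auto
  have ew: "exp w = (real p / M) powr (\<sigma> - 1)" using M p by (simp add: w_def powr_def)
  have pM: "(real p / M) powr (\<sigma> - 1) * (real p / M) = (real p / M) powr \<sigma>"
    using M p by (simp add: powr_diff)
  have "exp ((1 + 1 / (\<sigma> - 1)) * w) = exp w * exp (1 / (\<sigma> - 1) * w)"
    by (simp only: distrib_right exp_add mult_1)
  also have "exp (1 / (\<sigma> - 1) * w) = real p / M" using M p assms by (simp add: w_def)
  finally have f: "f_fun \<rho> \<sigma> x = exp (- \<rho> * (w * (real p / M) powr \<sigma>))"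
    using f_fun_eq_exp[OF assms(1) x(1), of \<rho>] by (simp only: wx ew pM)
  have py: "real p * y = M * (w * (real p / M) powr \<sigma>)"
    unfolding y_def ew pM[symmetric] using M by simp
  define B where "B = C powr (real p powr \<sigma>' + 1) * real p powr (\<tau> * real p powr \<sigma>')"
  have B: "B = exp ((real p powr \<sigma>' + 1) * ln C + \<tau> * real p powr \<sigma>' * ln (real p))"
    using \<open>C > 0\<close> p by (simp add: B_def powr_def exp_add)
  have zero: "(deriv ^^ p) (f_fun \<rho> \<sigma>) 0 = 0" for p
    using f_fun_higher_deriv[OF assms(1,2), of p] by blast
  have "\<bar>f_fun \<rho> \<sigma> x\<bar> \<le> B * \<bar>x\<bar> ^ p"
  proof (rule abs_le_of_flat_Maclaurin[OF smooth zero])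
    fix t assume "\<bar>t\<bar> \<le> \<bar>x\<bar>"
    then have "t \<in> {- 1..1}" using x by auto
    from C[OF this, of p] show "\<bar>(deriv ^^ p) (f_fun \<rho> \<sigma>) t\<bar> \<le> B"
      using p by (simp add: B_def M_seq_def)
  qed
  also have "\<dots> \<le> B * exp (1 - y) ^ p"
    using xy x by (intro mult_left_mono power_mono) (auto simp: B)
  also have "\<dots> = exp ((real p powr \<sigma>' + 1) * ln C + \<tau> * real p powr \<sigma>' * ln (real p) + real p * (1 - y))"
    by (simp add: B exp_add exp_of_nat_mult)
  finally have "- \<rho> * (w * (real p / M) powr \<sigma>)
      \<le> (real p powr \<sigma>' + 1) * ln C + \<tau> * real p powr \<sigma>' * ln (real p) + (real p - real p * y)"
    by (simp add: f right_diff_distrib)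
  then have "w * (real p / M) powr \<sigma>
      \<le> real p + (real p powr \<sigma>' + 1) * ln C + \<tau> * real p powr \<sigma>' * ln (real p)"
    unfolding py by (simp add: M_def algebra_simps)
  with p(1) show False by (simp add: w_def)
qed

theorem proposition2p18:
  fixes \<sigma> \<rho> :: real
  assumes "\<sigma> > 1" and "\<rho> > 0"
  shows "f_fun \<rho> \<sigma> \<in> ext_gevrey_union \<sigma> - (\<Union>\<sigma>'\<in>{1<..<\<sigma>}. ext_gevrey_union \<sigma>')"
  using f_fun_in_ext_gevrey_union[OF assms] f_fun_notin_ext_gevrey_union[OF assms] by auto

end
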